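(* Let $M$ be an integer such that $M+1\ge 2$ and $M+1$ is congruent to $1$ or $4$ modulo $5$, and let $N\ge 1$ and $k\ge 0$ be integers. The number of partitions of $N$ into parts congruent to $1$ or $4$ modulo $5$ in which the part $M+1$ occurs exactly $k$ times is equal to the number of partitions $\lambda\in \mathsf{Diff_2}$ of $N$ such that one of the following holds: (1) $\lambda$ consists of exactly one part, and its size is $N=(M+1)k+i$ for some $0\le i\le M$; (2) $\lambda$ has between $2$ and $M$ parts (inclusive), and the number of $1$'s in $col(\lambda)$ is between $(M+1)k$ and $(M+1)k+M$ (inclusive); (3) $\lambda$ has at least $M+1$ parts, and $col(\lambda)$ has exactly $k$ parts equal to $M+1$.
   Context: Partitions are written with weakly decreasing positive parts. $\mathsf{Diff_2}$ is the set of partitions $\lambda=(\lambda_1,\dots,\lambda_m)$ whose consecutive differences are at least two, i.e. $\lambda_i-\lambda_{i+1}\ge 2$ for $1\le i<m$. For $\lambda=(\lambda_1,\dots,\lambda_m)\in\mathsf{Diff_2}$, $col(\lambda)$ is the partition formed by the columns of (i.e. the conjugate of) $(\lambda_1-(2m-1),\lambda_2-(2m-3),\dots,\lambda_m-1)$, where zero entries are ignored. Example: $col((16,12,7,4,1))=(7,5,2,1,0)^T=(4,3,2,2,2,1,1)$. *)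

theory Defs
  imports Main
begin

definition is_partition :: "nat list \<Rightarrow> bool" where
  "is_partition p \<longleftrightarrow> sorted_wrt (\<ge>) p \<and> (\<forall>x\<in>set p. 0 < x)"

definition partitions_of :: "nat \<Rightarrow> nat list set" where
  "partitions_of N = {p. is_partition p \<and> sum_list p = N}"

text \<open>The difference condition is written additively to avoid truncated subtraction.\<close>

definition Diff2 :: "nat list set" where
  "Diff2 = {p. is_partition p \<and> (\<forall>i. i + 1 < length p \<longrightarrow> p ! (i + 1) + 2 \<le> p ! i)}"

text \<open>The entry at index \<open>j\<close> is the height of column \<open>j\<close> of the diagram with rows \<open>xs\<close>.
  Zero rows contribute to no column, and every listed column is non-empty.\<close>

definition conjugate :: "nat list \<Rightarrow> nat list" where
  "conjugate xs = map (\<lambda>j. length (filter (\<lambda>x. j < x) xs)) [0..<Max (insert 0 (set xs))]"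

text \<open>Indices start at 0 here, so the staircase \<open>2m - 1, 2m - 3, \<dots>, 1\<close> has entry
  \<open>2 (m - i) - 1\<close> at index \<open>i\<close>. On \<open>Diff2\<close> the outer subtraction is never truncated, see
  \<open>Diff2_staircase\<close> below.\<close>

definition col :: "nat list \<Rightarrow> nat list" where
  "col p = (let m = length p in conjugate (map (\<lambda>i. p ! i - (2 * (m - i) - 1)) [0..<m]))"

lemma finite_partitions_of: "finite (partitions_of N)"
proof (rule finite_subset)
  have len: "length p \<le> sum_list p" if "\<forall>x\<in>set p. 0 < x" for p :: "nat list"
    using that by (induction p) auto
  show "partitions_of N \<subseteq> {p. set p \<subseteq> {..N} \<and> length p \<le> N}"
    using len member_le_sum_list by (fastforce simp: partitions_of_def is_partition_def)
  show "finite {p. set p \<subseteq> {..N} \<and> length p \<le> N}"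
    by (rule finite_lists_length_le) simp
qed

lemma Diff2_staircase:
  assumes "p \<in> Diff2" and "i < length p"
  shows "2 * (length p - i) - 1 \<le> p ! i"
proof -
  have "2 * d + 1 \<le> p ! i" if "i + d + 1 = length p" for d i
    using that
  proof (induction d arbitrary: i)
    case 0
    then show ?case
      using assms(1) by (fastforce simp: Diff2_def is_partition_def Suc_le_eq)
  next
    case (Suc d)
    then have "2 * d + 1 \<le> p ! (i + 1)" by simp
    moreover have "p ! (i + 1) + 2 \<le> p ! i"
      using assms(1) Suc.prems unfolding Diff2_def by auto
    ultimately show ?case by simp
  qed
  from this[where i = i and d = "length p - i - 1"] assms(2) show ?thesis by linarith
qed

lemma col_example: "col [16, 12, 7, 4, 1] = [4, 3, 2, 2, 2, 1, 1]"
  by code_simp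

end

theory Submission
  imports Defs "HOL-Computational_Algebra.Formal_Power_Series" "HOL-Library.Multiset"
begin

text \<open>The rows of \<open>\<lambda> \<in> Diff2\<close> with \<open>m\<close> parts lie above the staircase \<open>1 + 3 + \<dots> + (2m - 1) = m\<^sup>2\<close>,
  so \<open>\<lambda>\<close> corresponds to the partition \<open>col \<lambda>\<close> of \<open>\<bar>\<lambda>\<bar> - m\<^sup>2\<close> into parts at most \<open>m\<close>, with generating
  function \<open>q\<^bsup>m\<^sup>2\<^esup> / (q)\<^sub>m\<close>. Prescribing that \<open>M + 1\<close> occurs exactly \<open>k\<close> times in \<open>col \<lambda>\<close>, or that \<open>1\<close>
  occurs between \<open>(M + 1) k\<close> and \<open>(M + 1) k + M\<close> times, multiplies this by the same factor
  \<open>C = q\<^bsup>(M + 1) k\<^esup> (1 - q\<^bsup>M + 1\<^esup>)\<close>; one-part partitions account for the terms \<open>m = 0\<close> and \<open>m = 1\<close>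
  together, as \<open>C (1 + q / (1 - q)) = C / (1 - q)\<close>. Prescribing the multiplicity of \<open>M + 1\<close> among
  the parts congruent to 1 or 4 modulo 5 also gives the factor \<open>C\<close>, and the first Rogers--Ramanujan
  identity, multiplied by \<open>C\<close>, is the claim. The identity follows by applying the Bailey lemma twice to
  the unit Bailey pair and comparing with a finite form of the Jacobi triple product. All limits are
  replaced by congruences modulo a power of \<open>X\<close>.\<close>

unbundle fps_syntax

section \<open>Bailey pairs\<close>

text \<open>This is 1/(q;q)_n. The base \<open>q\<close> is a parameter because both
  \<open>fps_X\<close> and \<open>fps_X ^ 5\<close> occur.\<close>

definition recip_qpoch :: "'a::field fps \<Rightarrow> nat \<Rightarrow> 'a fps" where
  "recip_qpoch q n = (\<Prod>i=1..n. inverse (1 - q ^ i))"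

lemma one_minus_mult_inverse:
  fixes f :: "'a::field fps"
  assumes "f $ 0 = 0"
  shows "(1 - f) * inverse (1 - f) = 1"
  using inverse_mult_eq_1[of "1 - f"] assms by (simp add: mult.commute)

lemma recip_qpoch_0 [simp]: "recip_qpoch q 0 = 1"
  by (simp add: recip_qpoch_def)

lemma recip_qpoch_Suc:
  assumes "q $ 0 = 0"
  shows "(1 - q ^ Suc n) * recip_qpoch q (Suc n) = recip_qpoch q n"
proof -
  have "(1 - q ^ Suc n) * inverse (1 - q ^ Suc n) = 1"
    using assms by (intro one_minus_mult_inverse) simp
  then show ?thesis
    by (simp add: recip_qpoch_def mult.left_commute del: power_Suc)
qed

lemma one_minus_power_neq_0:
  fixes q :: "'a::field fps"
  assumes "q $ 0 = 0"
  shows "1 - q ^ Suc n \<noteq> 0"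
proof
  assume "1 - q ^ Suc n = 0"
  then have "(1 - q ^ Suc n) $ 0 = 0" by (simp only: fps_zero_nth)
  then show False using assms by simp
qed

text \<open>Split \<open>1 - q\<^bsup>n+1\<^esup> = (1 - q\<^bsup>n+1-t\<^esup>) + q\<^bsup>n+1-t\<^esup> (1 - q\<^sup>t)\<close>: each half lowers one of the two indices.\<close>

lemma q_split_sum:
  fixes q :: "'a::field fps"
  assumes "q $ 0 = 0"
  shows "(1 - q ^ Suc n) * (\<Sum>t\<le>Suc n. recip_qpoch q (Suc n - t) * recip_qpoch q t * g t)
       = (\<Sum>t\<le>n. recip_qpoch q (n - t) * recip_qpoch q t * (g t + q ^ (n - t) * g (Suc t)))"
proof -
  let ?r = "recip_qpoch q"
  have split: "(1 - q ^ Suc n) * (?r (Suc n - t) * ?r t * g t)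
      = (1 - q ^ (Suc n - t)) * ?r (Suc n - t) * ?r t * g t
        + q ^ (Suc n - t) * ((1 - q ^ t) * ?r t) * ?r (Suc n - t) * g t" if "t \<le> Suc n" for t
  proof -
    have "q ^ Suc n = q ^ (Suc n - t) * q ^ t"
      using that by (simp flip: power_add del: power_Suc)
    then show ?thesis by (simp add: algebra_simps del: power_Suc)
  qed
  have 1: "(\<Sum>t\<le>Suc n. (1 - q ^ (Suc n - t)) * ?r (Suc n - t) * ?r t * g t)
      = (\<Sum>t\<le>n. ?r (n - t) * ?r t * g t)"
  proof -
    have "(\<Sum>t\<le>Suc n. (1 - q ^ (Suc n - t)) * ?r (Suc n - t) * ?r t * g t)
        = (\<Sum>t\<le>n. (1 - q ^ (Suc n - t)) * ?r (Suc n - t) * ?r t * g t)"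
      by simp
    also have "\<dots> = (\<Sum>t\<le>n. ?r (n - t) * ?r t * g t)"
      by (intro sum.cong refl) (simp add: Suc_diff_le recip_qpoch_Suc[OF assms] del: power_Suc)
    finally show ?thesis .
  qed
  have 2: "(\<Sum>t\<le>Suc n. q ^ (Suc n - t) * ((1 - q ^ t) * ?r t) * ?r (Suc n - t) * g t)
      = (\<Sum>t\<le>n. ?r (n - t) * ?r t * (q ^ (n - t) * g (Suc t)))"
    by (subst sum.atMost_Suc_shift)
       (simp add: recip_qpoch_Suc[OF assms] del: power_Suc sum.atMost_Suc, simp add: mult_ac)
  show ?thesis
    unfolding sum_distrib_left
    by (subst sum.cong[OF refl split])
       (simp_all add: sum.distrib 1 2 distrib_left del: power_Suc sum.atMost_Suc)
qed

text \<open>After multiplication by \<open>1 - q ^ Suc n\<close> the splitting yields the sum for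
  (n, r) plus \<open>q ^ (Suc n + r)\<close> times the sum for (n, r + 1), which is why
  \<open>r\<close> varies in the induction. The two values combine because
  \<open>recip_qpoch q (n + r)\<close> is \<open>1 - q ^ (Suc n + r)\<close> times
  \<open>recip_qpoch q (Suc n + r)\<close>.\<close>

lemma q_vandermonde:
  fixes q :: "'a::field fps"
  assumes "q $ 0 = 0"
  shows "(\<Sum>t\<le>n. recip_qpoch q (n - t) * recip_qpoch q t * (q ^ (t * (t + r)) * recip_qpoch q (t + r)))
       = recip_qpoch q n * recip_qpoch q (n + r)"
proof (induction n arbitrary: r)
  case 0
  show ?case by simp
next
  case (Suc n)
  let ?r = "recip_qpoch q"
  have tm: "?r (n - t) * ?r t * (q ^ (t * (t + r)) * ?r (t + r)
          + q ^ (n - t) * (q ^ (Suc t * (Suc t + r)) * ?r (Suc t + r)))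
      = ?r (n - t) * ?r t * (q ^ (t * (t + r)) * ?r (t + r))
        + q ^ (Suc n + r) * (?r (n - t) * ?r t * (q ^ (t * (t + Suc r)) * ?r (t + Suc r)))"
    if "t \<le> n" for t
  proof -
    have "n - t + Suc t * (Suc t + r) = Suc n + r + t * (t + Suc r)"
      using that by (simp add: algebra_simps)
    then have "q ^ (n - t) * q ^ (Suc t * (Suc t + r)) = q ^ (Suc n + r) * q ^ (t * (t + Suc r))"
      by (simp only: flip: power_add)
    then show ?thesis by (simp add: algebra_simps del: power_Suc mult_Suc mult_Suc_right)
  qed
  have "(1 - q ^ Suc n) * (\<Sum>t\<le>Suc n. ?r (Suc n - t) * ?r t * (q ^ (t * (t + r)) * ?r (t + r)))
      = ?r n * ?r (n + r) + q ^ (Suc n + r) * (?r n * ?r (n + Suc r))"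
    unfolding q_split_sum[OF assms]
    by (subst sum.cong[OF refl tm])
       (simp, simp only: sum.distrib Suc.IH flip: sum_distrib_left)
  also have "?r (n + r) = (1 - q ^ (Suc n + r)) * ?r (Suc n + r)"
    using recip_qpoch_Suc[OF assms, of "n + r"] by simp
  also have "?r n = (1 - q ^ Suc n) * ?r (Suc n)"
    using recip_qpoch_Suc[OF assms, of n] by simp
  finally have "(1 - q ^ Suc n) * (\<Sum>t\<le>Suc n. ?r (Suc n - t) * ?r t * (q ^ (t * (t + r)) * ?r (t + r)))
      = (1 - q ^ Suc n) * (?r (Suc n) * ?r (Suc n + r))"
    by (simp add: algebra_simps del: power_Suc sum.atMost_Suc)
  then show ?case
    using one_minus_power_neq_0[OF assms] by (simp only: mult_cancel_left) simp
qed

text \<open>The q-binomial theorem in homogeneous form. After the splitting, the term of index k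
  takes \<open>a\<close> from its own monomial and \<open>- b * q ^ n\<close> from the next one, so
  each induction step contributes one factor \<open>a - b * q ^ n\<close>.\<close>

lemma q_binomial:
  fixes q :: "'a::field fps"
  assumes "q $ 0 = 0"
  shows "(\<Sum>k\<le>n. recip_qpoch q (n - k) * recip_qpoch q k
            * ((-1) ^ k * q ^ (k choose 2) * b ^ k * a ^ (n - k)))
       = recip_qpoch q n * (\<Prod>i<n. a - b * q ^ i)"
proof (induction n)
  case 0
  show ?case by (simp add: binomial_eq_0)
next
  case (Suc n)
  let ?r = "recip_qpoch q"
  have tm: "?r (n - k) * ?r k * ((-1) ^ k * q ^ (k choose 2) * b ^ k * a ^ (Suc n - k)
          + q ^ (n - k) * ((-1) ^ Suc k * q ^ (Suc k choose 2) * b ^ Suc k * a ^ (Suc n - Suc k)))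
      = (a - b * q ^ n) * (?r (n - k) * ?r k * ((-1) ^ k * q ^ (k choose 2) * b ^ k * a ^ (n - k)))"
    if "k \<le> n" for k
  proof -
    have "q ^ (Suc k choose 2) = q ^ k * q ^ (k choose 2)"
      by (simp add: numeral_2_eq_2 power_add)
    moreover have "q ^ n = q ^ (n - k) * q ^ k"
      using that by (simp flip: power_add)
    moreover have "Suc n - k = Suc (n - k)" using that by simp
    ultimately show ?thesis by (simp add: algebra_simps)
  qed
  have "(1 - q ^ Suc n) * (\<Sum>k\<le>Suc n. ?r (Suc n - k) * ?r k
            * ((-1) ^ k * q ^ (k choose 2) * b ^ k * a ^ (Suc n - k)))
      = (a - b * q ^ n) * (?r n * (\<Prod>i<n. a - b * q ^ i))"
    unfolding q_split_sum[OF assms]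
    by (subst sum.cong[OF refl tm]) (simp_all add: Suc.IH flip: sum_distrib_left)
  also have "?r n = (1 - q ^ Suc n) * ?r (Suc n)"
    using recip_qpoch_Suc[OF assms, of n] by simp
  finally have "(1 - q ^ Suc n) * (\<Sum>k\<le>Suc n. ?r (Suc n - k) * ?r k
            * ((-1) ^ k * q ^ (k choose 2) * b ^ k * a ^ (Suc n - k)))
      = (1 - q ^ Suc n) * (?r (Suc n) * (\<Prod>i<Suc n. a - b * q ^ i))"
    by (simp add: mult_ac del: power_Suc sum.atMost_Suc)
  then show ?case
    using one_minus_power_neq_0[OF assms] by (simp only: mult_cancel_left) simp
qed

text \<open>The terms of index \<open>m\<close> and \<open>-m\<close> in the Jacobi triple product for \<open>z\<close> and \<open>w = q / z\<close>.\<close>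

definition theta_coeff :: "'a::field fps \<Rightarrow> 'a fps \<Rightarrow> 'a fps \<Rightarrow> nat \<Rightarrow> 'a fps" where
  "theta_coeff q z w m = (if m = 0 then 1 else (-1) ^ m * q ^ (m choose 2) * (z ^ m + w ^ m))"

lemma choose_2_add: "(n + m) choose 2 = (n choose 2) + (m choose 2) + n * m"
  by (induction m) (simp_all add: numeral_2_eq_2)

lemma double_choose_2: "2 * (m choose 2) + m = m * m"
  by (induction m) (simp_all add: numeral_2_eq_2)

text \<open>The pairs of indices symmetric about the middle are what \<open>theta_coeff\<close>
  collects into one term.\<close>

lemma sum_fold_center:
  fixes f :: "nat \<Rightarrow> 'a::comm_monoid_add"
  shows "(\<Sum>k\<le>2 * n. f k) = f n + (\<Sum>m=1..n. f (n + m) + f (n - m))"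
proof -
  have "{..2 * n} = insert n ({..<n} \<union> {n<..2 * n})" by auto
  then have "(\<Sum>k\<le>2 * n. f k) = f n + sum f ({..<n} \<union> {n<..2 * n})"
    by simp
  moreover have "sum f ({..<n} \<union> {n<..2 * n}) = sum f {..<n} + sum f {n<..2 * n}"
    by (rule sum.union_disjoint) auto
  moreover have "sum f {..<n} = (\<Sum>m=1..n. f (n - m))"
    by (rule sum.reindex_bij_witness[of _ "\<lambda>m. n - m" "\<lambda>k. n - k"]) auto
  moreover have "sum f {n<..2 * n} = (\<Sum>m=1..n. f (n + m))"
    by (rule sum.reindex_bij_witness[of _ "\<lambda>m. n + m" "\<lambda>k. k - n"]) auto
  ultimately show ?thesis by (simp add: sum.distrib ac_simps)
qed

section \<open>Bailey pairs, the finite triple product and the Bailey lemma\<close>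

text \<open>A Bailey pair relative to a = 1, where the usual (aq;q)_{n+m} is (q;q)_{n+m}.\<close>

definition bailey_pair :: "'a::field fps \<Rightarrow> (nat \<Rightarrow> 'a fps) \<Rightarrow> (nat \<Rightarrow> 'a fps) \<Rightarrow> bool" where
  "bailey_pair q \<alpha> \<beta> \<longleftrightarrow>
     (\<forall>n. \<beta> n = (\<Sum>m\<le>n. \<alpha> m * recip_qpoch q (n - m) * recip_qpoch q (n + m)))"

text \<open>This is the finite form of the Jacobi triple product.\<close>

lemma bailey_pair_theta:
  fixes q :: "'a::field fps"
  assumes q: "q $ 0 = 0" "q \<noteq> 0" and zw: "z * w = q"
  shows "bailey_pair q (theta_coeff q z w)
           (\<lambda>n. recip_qpoch q (2 * n) * (\<Prod>i<n. (1 - z * q ^ i) * (1 - w * q ^ i)))"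
  unfolding bailey_pair_def
proof
  fix n
  let ?r = "recip_qpoch q"
  \<comment> \<open>In the product of \<open>q ^ n - z * q ^ i\<close> over i < 2n, the factors with
    i \<ge> n release \<open>q ^ n\<close> and those with i < n release \<open>- z * q ^ i\<close>;
    \<open>c\<close> collects all of these.\<close>
  define c where "c = (-1) ^ n * z ^ n * q ^ (n choose 2) * q ^ (n * n)"
  \<comment> \<open>The summand of \<open>q_binomial\<close> with \<open>2 * n\<close> for
    \<open>n\<close>, \<open>q ^ n\<close> for \<open>a\<close> and \<open>z\<close> for
    \<open>b\<close>; its middle index k = n becomes the term m = 0.\<close>
  define f where "f k = ?r (2 * n - k) * ?r k
            * ((-1) ^ k * q ^ (k choose 2) * z ^ k * (q ^ n) ^ (2 * n - k))" for k
  have z0: "z \<noteq> 0" using q zw by auto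
  have c0: "c \<noteq> 0" using q z0 by (simp add: c_def)
  have prod: "(\<Prod>i<2 * n. q ^ n - z * q ^ i) = c * (\<Prod>i<n. (1 - z * q ^ i) * (1 - w * q ^ i))"
  proof -
    have "(\<Prod>i<2 * n. q ^ n - z * q ^ i)
        = (\<Prod>i<n. q ^ n - z * q ^ i) * (\<Prod>i<n. q ^ n - z * q ^ (n + i))"
    proof -
      have "{..<2 * n} = {..<n} \<union> {n..<2 * n}" by auto
      then have "(\<Prod>i<2 * n. q ^ n - z * q ^ i)
        = (\<Prod>i<n. q ^ n - z * q ^ i) * (\<Prod>i=n..<2 * n. q ^ n - z * q ^ i)"
        by (simp add: prod.union_disjoint ivl_disj_int)
      moreover have "(\<Prod>i=n..<2 * n. q ^ n - z * q ^ i) = (\<Prod>i<n. q ^ n - z * q ^ (n + i))"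
        by (rule prod.reindex_bij_witness[of _ "\<lambda>m. n + m" "\<lambda>k. k - n"]) auto
      ultimately show ?thesis by simp
    qed
    also have "(\<Prod>i<n. q ^ n - z * q ^ (n + i)) = q ^ (n * n) * (\<Prod>i<n. 1 - z * q ^ i)"
    proof -
      have "(\<Prod>i<n. q ^ n - z * q ^ (n + i)) = (\<Prod>i<n. q ^ n * (1 - z * q ^ i))"
        by (intro prod.cong refl) (simp add: power_add algebra_simps)
      then show ?thesis by (simp add: prod.distrib power_mult)
    qed
    also have "(\<Prod>i<n. q ^ n - z * q ^ i)
        = (-1) ^ n * z ^ n * q ^ (n choose 2) * (\<Prod>i<n. 1 - w * q ^ i)"
    proof -
      have "(\<Prod>i<n. q ^ n - z * q ^ i) = (\<Prod>i<n. (- 1) * z * q ^ i * (1 - w * q ^ (n - 1 - i)))"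
      proof (intro prod.cong refl)
        fix i assume "i \<in> {..<n}"
        then have "n = Suc (i + (n - 1 - i))" by auto
        then have "q ^ n = (z * w) * q ^ i * q ^ (n - 1 - i)"
          using zw by (metis power_Suc power_add mult.assoc)
        then show "q ^ n - z * q ^ i = (- 1) * z * q ^ i * (1 - w * q ^ (n - 1 - i))"
          by (simp add: algebra_simps)
      qed
      also have "\<dots> = (-1) ^ n * z ^ n * (\<Prod>i<n. q ^ i) * (\<Prod>i<n. 1 - w * q ^ (n - 1 - i))"
        by (simp only: prod.distrib) (simp add: power_mult_distrib)
      also have "(\<Prod>i<n. 1 - w * q ^ (n - 1 - i)) = (\<Prod>i<n. 1 - w * q ^ i)"
        by (rule prod.reindex_bij_witness[of _ "\<lambda>i. n - 1 - i" "\<lambda>i. n - 1 - i"]) auto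
      also have "(\<Prod>i<n. q ^ i) = q ^ (n choose 2)"
        by (induction n) (simp_all add: numeral_2_eq_2 power_add)
      finally show ?thesis .
    qed
    finally show ?thesis by (simp add: c_def prod.distrib mult_ac)
  qed
  have fold: "f (n + m) + f (n - m) = c * (theta_coeff q z w m * ?r (n - m) * ?r (n + m))"
    if "m \<in> {1..n}" for m
  proof -
    have m: "m \<le> n" "m \<noteq> 0" using that by auto
    then obtain d where n: "n = d + m" by (metis le_add_diff_inverse2)
    have "f (n + m) = c * (-1) ^ m * q ^ (m choose 2) * z ^ m * ?r (n - m) * ?r (n + m)"
    proof -
      have e: "(n + m choose 2) + n * (n - m) = (n choose 2) + n * n + (m choose 2)"
        unfolding choose_2_add n by (simp add: algebra_simps)
      have "q ^ (n + m choose 2) * (q ^ n) ^ (n - m) = q ^ (n choose 2) * q ^ (n * n) * q ^ (m choose 2)"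
        using e by (simp flip: power_add power_mult)
      moreover have "2 * n - (n + m) = n - m" by simp
      ultimately show ?thesis by (simp add: f_def c_def power_add mult_ac)
    qed
    \<comment> \<open>The lower power \<open>z ^ (n - m)\<close> is traded for
      \<open>z ^ n * w ^ m\<close> by means of \<open>z * w = q\<close>; this consumes the extra
      \<open>q ^ m\<close> that the exponents leave over.\<close>
    moreover have "f (n - m) = c * (-1) ^ m * q ^ (m choose 2) * w ^ m * ?r (n - m) * ?r (n + m)"
    proof -
      have e: "(n - m choose 2) + n * (n + m) = (n choose 2) + n * n + (m choose 2) + m"
        unfolding n choose_2_add using double_choose_2[of m]
        by (simp add: algebra_simps)
      have "(-1) ^ (n - m) = (-1 :: 'a fps) ^ n * (-1) ^ m"
        unfolding n by (simp add: power_add flip: power_mult_distrib)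
      moreover have "z ^ n * w ^ m = z ^ (n - m) * q ^ m"
        unfolding n zw[symmetric] by (simp add: power_add power_mult_distrib mult_ac)
      moreover have "q ^ (n - m choose 2) * (q ^ n) ^ (n + m)
          = q ^ (n choose 2) * q ^ (n * n) * q ^ (m choose 2) * q ^ m"
        using e by (simp flip: power_add power_mult)
      moreover have "2 * n - (n - m) = n + m" using m by simp
      ultimately show ?thesis by (simp add: f_def c_def mult_ac)
    qed
    ultimately show ?thesis using m by (simp add: theta_coeff_def algebra_simps)
  qed
  have "c * (?r (2 * n) * (\<Prod>i<n. (1 - z * q ^ i) * (1 - w * q ^ i))) = (\<Sum>k\<le>2 * n. f k)"
    unfolding f_def q_binomial[OF q(1)] prod by (simp add: mult_ac)
  also have "\<dots> = f n + (\<Sum>m=1..n. f (n + m) + f (n - m))"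
    by (rule sum_fold_center)
  also have "f n = c * (theta_coeff q z w 0 * ?r (n - 0) * ?r (n + 0))"
    by (simp add: f_def c_def theta_coeff_def power_mult mult_ac)
  also have "(\<Sum>m=1..n. f (n + m) + f (n - m))
      = (\<Sum>m=1..n. c * (theta_coeff q z w m * ?r (n - m) * ?r (n + m)))"
    by (intro sum.cong refl fold)
  also have "c * (theta_coeff q z w 0 * ?r (n - 0) * ?r (n + 0)) + \<dots>
      = c * (\<Sum>m\<le>n. theta_coeff q z w m * ?r (n - m) * ?r (n + m))"
    by (simp add: sum.atMost_shift sum_distrib_left distrib_left sum.shift_bounds_Suc_ivl
        atLeast0AtMost atLeastLessThanSuc_atLeastAtMost sum.atLeast1_atMost_eq)
  finally show "?r (2 * n) * (\<Prod>i<n. (1 - z * q ^ i) * (1 - w * q ^ i))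
      = (\<Sum>m\<le>n. theta_coeff q z w m * ?r (n - m) * ?r (n + m))"
    using c0 by (simp only: mult_cancel_left) simp
qed

text \<open>The case a = 1 of Bailey's lemma with both free parameters sent to infinity. Once the
  sums are exchanged and s = t + m is substituted, \<open>q ^ (s * s)\<close> splits into
  \<open>q ^ (m * m)\<close> and \<open>q ^ (t * (t + 2 * m))\<close>, and the inner sum is
  \<open>q_vandermonde\<close> with \<open>n - m\<close> for \<open>n\<close> and
  \<open>2 * m\<close> for \<open>r\<close>.\<close>

lemma bailey_lemma:
  fixes q :: "'a::field fps"
  assumes q: "q $ 0 = 0" and pair: "bailey_pair q \<alpha> \<beta>"
  shows "bailey_pair q (\<lambda>m. q ^ (m * m) * \<alpha> m)
           (\<lambda>n. \<Sum>s\<le>n. q ^ (s * s) * recip_qpoch q (n - s) * \<beta> s)"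
  unfolding bailey_pair_def
proof
  fix n
  let ?r = "recip_qpoch q"
  have "(\<Sum>s\<le>n. q ^ (s * s) * ?r (n - s) * \<beta> s)
      = (\<Sum>s\<le>n. \<Sum>m\<le>s. q ^ (s * s) * ?r (n - s) * (\<alpha> m * ?r (s - m) * ?r (s + m)))"
    using pair by (simp add: bailey_pair_def sum_distrib_left)
  also have "\<dots> = (\<Sum>m\<le>n. \<Sum>s=m..n. q ^ (s * s) * ?r (n - s) * (\<alpha> m * ?r (s - m) * ?r (s + m)))"
    unfolding sum.Sigma[OF finite_atMost ballI[OF finite_atMost]]
      sum.Sigma[OF finite_atMost ballI[OF finite_atLeastAtMost]]
    by (rule sum.reindex_bij_witness[of _ "\<lambda>(a, b). (b, a)" "\<lambda>(a, b). (b, a)"]) auto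
  also have "\<dots> = (\<Sum>m\<le>n. q ^ (m * m) * \<alpha> m * ?r (n - m) * ?r (n + m))"
  proof (intro sum.cong refl)
    fix m assume "m \<in> {..n}"
    then have m: "m \<le> n" by simp
    have "(\<Sum>s=m..n. q ^ (s * s) * ?r (n - s) * (\<alpha> m * ?r (s - m) * ?r (s + m)))
        = (\<Sum>t\<le>n - m. q ^ ((t + m) * (t + m)) * ?r (n - m - t) * (\<alpha> m * ?r t * ?r (t + 2 * m)))"
      by (rule sum.reindex_bij_witness[of _ "\<lambda>t. t + m" "\<lambda>s. s - m"])
         (use m in \<open>auto simp: mult_2 add_ac\<close>)
    also have "\<dots> = (\<Sum>t\<le>n - m. q ^ (m * m) * \<alpha> m
        * (?r (n - m - t) * ?r t * (q ^ (t * (t + 2 * m)) * ?r (t + 2 * m))))"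
    proof (intro sum.cong refl)
      fix t
      have "(t + m) * (t + m) = m * m + t * (t + 2 * m)" by (simp add: algebra_simps)
      then show "q ^ ((t + m) * (t + m)) * ?r (n - m - t) * (\<alpha> m * ?r t * ?r (t + 2 * m))
        = q ^ (m * m) * \<alpha> m * (?r (n - m - t) * ?r t * (q ^ (t * (t + 2 * m)) * ?r (t + 2 * m)))"
        by (simp add: power_add mult_ac)
    qed
    also have "\<dots> = q ^ (m * m) * \<alpha> m * (?r (n - m) * ?r (n - m + 2 * m))"
      by (simp only: q_vandermonde[OF q] flip: sum_distrib_left)
    also have "n - m + 2 * m = n + m" using m by simp
    finally show "(\<Sum>s=m..n. q ^ (s * s) * ?r (n - s) * (\<alpha> m * ?r (s - m) * ?r (s + m)))
        = q ^ (m * m) * \<alpha> m * ?r (n - m) * ?r (n + m)"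
      by (simp add: mult_ac)
  qed
  finally show "(\<Sum>s\<le>n. q ^ (s * s) * ?r (n - s) * \<beta> s)
      = (\<Sum>m\<le>n. q ^ (m * m) * \<alpha> m * ?r (n - m) * ?r (n + m))" .
qed

section \<open>The first Rogers--Ramanujan identity\<close>

lemma X_power_dvd_trans:
  fixes f g h :: "'a::comm_ring_1 fps"
  assumes "fps_X ^ K dvd f - g" "fps_X ^ K dvd g - h"
  shows "fps_X ^ K dvd f - h"
  using dvd_add[OF assms] by simp

lemma X_power_dvd_sym:
  fixes f g :: "'a::comm_ring_1 fps"
  assumes "fps_X ^ K dvd f - g"
  shows "fps_X ^ K dvd g - f"
  using assms dvd_minus_iff[of "fps_X ^ K" "f - g"] by simp

text \<open>Raising the index from b to b + 1 divides by 1 - X^(c (b + 1)), which alters only terms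
  of order at least c (b + 1). Hence a large finite index can stand for the infinite
  product.\<close>

lemma recip_qpoch_stable:
  assumes "0 < c" "a \<le> b"
  shows "fps_X ^ (c * Suc a) dvd recip_qpoch (fps_X ^ c :: 'a::field fps) a - recip_qpoch (fps_X ^ c) b"
  using assms(2)
proof (induction b rule: dec_induct)
  case base
  show ?case by simp
next
  case (step b)
  let ?r = "recip_qpoch (fps_X ^ c :: 'a fps)"
  have "?r b = (1 - (fps_X ^ c) ^ Suc b) * ?r (Suc b)"
    using assms(1) by (simp add: recip_qpoch_Suc del: power_Suc)
  then have "?r b - ?r (Suc b) = fps_X ^ (c * Suc b) * (- ?r (Suc b))"
    by (simp add: algebra_simps del: power_Suc mult_Suc_right flip: power_mult)
  moreover have "fps_X ^ (c * Suc a) dvd (fps_X ^ (c * Suc b) :: 'a fps)"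
    using step by (intro le_imp_power_dvd mult_le_mono) auto
  ultimately have "fps_X ^ (c * Suc a) dvd ?r b - ?r (Suc b)"
    by (simp del: power_Suc mult_Suc_right)
  with step.IH show ?case by (rule X_power_dvd_trans)
qed

lemma recip_qpoch_stable':
  assumes "0 < c" "a \<le> b" "K \<le> Suc a"
  shows "fps_X ^ K dvd recip_qpoch (fps_X ^ c :: 'a::field fps) a - recip_qpoch (fps_X ^ c) b"
proof -
  have "K \<le> c * Suc a" using assms(1,3) mult_le_mono1[of 1 c "Suc a"] by simp
  then show ?thesis
    using recip_qpoch_stable[OF assms(1,2)] power_le_dvd by blast
qed

text \<open>The recursion makes \<open>recip_qpoch q (Suc n)\<close> a divisor of
  \<open>recip_qpoch q n\<close>, and a divisor of a unit is a unit.\<close>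

lemma is_unit_recip_qpoch:
  fixes q :: "'a::field fps"
  assumes "q $ 0 = 0"
  shows "recip_qpoch q n dvd 1"
proof (induction n)
  case (Suc n)
  then show ?case
    unfolding recip_qpoch_Suc[OF assms, of n, symmetric] by (rule dvd_mult_right)
qed simp

lemma dvd_recip_qpoch_mult_cancel:
  fixes q :: "'a::field fps"
  assumes "q $ 0 = 0" "f dvd recip_qpoch q n * g"
  shows "f dvd g"
  using assms(2) dvd_mult_unit_iff'[OF is_unit_recip_qpoch[OF assms(1)]] by blast

text \<open>Replacing the index L - m by L costs an error of order only L - m + 1, but the factor
  \<open>\<alpha> m\<close> supplies the missing m. Replacing L + m by L costs an error of order L +
  1 at once.\<close>

lemma bailey_pair_limit:
  fixes \<alpha> :: "nat \<Rightarrow> 'a::field fps"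
  assumes c: "0 < c" and pair: "bailey_pair (fps_X ^ c) \<alpha> \<beta>" and \<alpha>: "\<And>m. fps_X ^ m dvd \<alpha> m"
  shows "fps_X ^ Suc L dvd
    \<beta> L - recip_qpoch (fps_X ^ c) L * (recip_qpoch (fps_X ^ c) L * (\<Sum>m\<le>L. \<alpha> m))"
proof -
  let ?r = "recip_qpoch (fps_X ^ c :: 'a fps)"
  have "fps_X ^ Suc L dvd \<alpha> m * (?r (L - m) * ?r (L + m) - ?r L * ?r L)" if "m \<le> L" for m
  proof -
    have "fps_X ^ (m + Suc (L - m)) dvd \<alpha> m * (?r (L - m) - ?r L)"
      unfolding power_add by (intro mult_dvd_mono \<alpha> recip_qpoch_stable'[OF c]) auto
    moreover have "m + Suc (L - m) = Suc L" using that by simp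
    ultimately have 1: "fps_X ^ Suc L dvd \<alpha> m * (?r (L - m) - ?r L) * ?r (L + m)"
      by (metis dvd_mult2)
    have "fps_X ^ Suc L dvd ?r (L + m) - ?r L"
      by (rule X_power_dvd_sym, rule recip_qpoch_stable'[OF c]) auto
    then have 2: "fps_X ^ Suc L dvd \<alpha> m * ?r L * (?r (L + m) - ?r L)"
      by (rule dvd_mult)
    from dvd_add[OF 1 2] show ?thesis by (simp add: algebra_simps del: power_Suc)
  qed
  then have "fps_X ^ Suc L dvd (\<Sum>m\<le>L. \<alpha> m * (?r (L - m) * ?r (L + m) - ?r L * ?r L))"
    by (intro dvd_sum) auto
  also have "\<dots> = \<beta> L - ?r L * (?r L * (\<Sum>m\<le>L. \<alpha> m))"
    using pair unfolding bailey_pair_def sum_distrib_left right_diff_distrib sum_subtractf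
    by (simp add: mult_ac)
  finally show ?thesis .
qed

section \<open>The truncated first Rogers-Ramanujan identity\<close>

text \<open>Sorting the factors of 1/(X;X)_{5L} by exponent modulo 5, the residues 2 and 3 cancel
  against the product, residue 0 forms \<open>recip_qpoch (fps_X ^ 5) L\<close>, and residues 1 and
  4 remain.\<close>

lemma recip_qpoch_mod_5:
  "recip_qpoch (fps_X :: 'a::field fps) (5 * L)
     * (\<Prod>i<L. (1 - fps_X\<^sup>2 * (fps_X ^ 5) ^ i) * (1 - fps_X ^ 3 * (fps_X ^ 5) ^ i))
   = recip_qpoch (fps_X ^ 5) L * (\<Prod>i<L. inverse (1 - fps_X ^ (5 * i + 1)) * inverse (1 - fps_X ^ (5 * i + 4)))"
proof (induction L)
  case (Suc L)
  let ?r = "recip_qpoch (fps_X :: 'a fps)" and ?r5 = "recip_qpoch (fps_X ^ 5 :: 'a fps)"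
  let ?P = "\<lambda>L. \<Prod>i<L. (1 - fps_X\<^sup>2 * (fps_X ^ 5) ^ i) * (1 - fps_X ^ 3 * (fps_X ^ 5) ^ i) :: 'a fps"
  let ?G = "\<lambda>L. \<Prod>i<L. inverse (1 - fps_X ^ (5 * i + 1)) * inverse (1 - fps_X ^ (5 * i + 4)) :: 'a fps"
  define y where "y j = (1 - fps_X ^ (5 * L + j) :: 'a fps)" for j
  have y: "y j * inverse (y j) = 1" if "0 < j" for j
    unfolding y_def using that by (intro one_minus_mult_inverse) simp
  have "5 * Suc L = Suc (Suc (Suc (Suc (Suc (5 * L)))))" by simp
  then have "?r (5 * Suc L) = ?r (5 * L) * inverse (y 1) * inverse (y 2) * inverse (y 3)
      * inverse (y 4) * inverse (y 5)"
    by (simp add: recip_qpoch_def y_def eval_nat_numeral mult_ac)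
  moreover have "?P (Suc L) = ?P L * y 2 * y 3"
    by (simp add: y_def add.commute flip: power_mult power_add)
  ultimately have "?r (5 * Suc L) * ?P (Suc L)
      = (?r (5 * L) * ?P L) * inverse (y 1) * inverse (y 4) * inverse (y 5)
        * (y 2 * inverse (y 2)) * (y 3 * inverse (y 3))"
    by (simp only: mult_ac)
  also have "\<dots> = ?r5 L * ?G L * inverse (y 1) * inverse (y 4) * inverse (y 5)"
    by (simp add: y Suc.IH)
  also have "?r5 L * ?G L * inverse (y 1) * inverse (y 4) * inverse (y 5)
      = (?r5 L * inverse (y 5)) * (?G L * (inverse (y 1) * inverse (y 4)))"
    by (simp only: mult_ac)
  also have "?r5 L * inverse (y 5) = ?r5 (Suc L)"
    by (simp add: recip_qpoch_def y_def add.commute flip: power_mult)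
  also have "?G L * (inverse (y 1) * inverse (y 4)) = ?G (Suc L)"
    by (simp add: y_def)
  finally show ?case .
qed simp

text \<open>One sequence \<open>\<alpha>\<close> belongs to Bailey pairs in two bases: in base X by
  iterating the Bailey lemma, in base X^5 by the triple product. The limits of both pairs involve
  the same sum \<open>\<Theta>\<close>, and eliminating it links the sum side to the product
  side.\<close>

lemma rogers_ramanujan_truncated:
  "(fps_X :: 'a::field fps) ^ Suc L dvd (\<Sum>s\<le>L. fps_X ^ (s * s) * recip_qpoch fps_X s)
     - (\<Prod>i<L. inverse (1 - fps_X ^ (5 * i + 1)) * inverse (1 - fps_X ^ (5 * i + 4)))"
proof -
  let ?X = "fps_X :: 'a fps"
  let ?r = "recip_qpoch ?X" and ?r5 = "recip_qpoch (?X ^ 5)"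
  define \<alpha> where "\<alpha> = theta_coeff (?X ^ 5) (?X\<^sup>2) (?X ^ 3)"
  define P where "P n = (\<Prod>i<n. (1 - ?X\<^sup>2 * (?X ^ 5) ^ i) * (1 - ?X ^ 3 * (?X ^ 5) ^ i))" for n
  define G where "G = (\<Prod>i<L. inverse (1 - ?X ^ (5 * i + 1)) * inverse (1 - ?X ^ (5 * i + 4)))"
  define S where "S = (\<Sum>s\<le>L. ?X ^ (s * s) * ?r s)"
  define \<Theta> where "\<Theta> = (\<Sum>m\<le>L. \<alpha> m)"
  \<comment> \<open>This is the link between the bases: by \<open>double_choose_2\<close>, both
    exponents of the base X^5 coefficient exceed those of the base X coefficient with z = 1 by 2
    m^2, exactly what two applications of the Bailey lemma add.\<close>
  have \<alpha>: "\<alpha> m = ?X ^ (m * m) * (?X ^ (m * m) * theta_coeff ?X 1 ?X m)" for m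
  proof -
    let ?b = "m choose 2"
    have "5 * ?b + 2 * m = m * m + (m * m + ?b)" "5 * ?b + 3 * m = m * m + (m * m + (?b + m))"
      using double_choose_2[of m] by auto
    then have "?X ^ (5 * ?b) * ?X ^ (2 * m) = ?X ^ (m * m) * (?X ^ (m * m) * ?X ^ ?b)"
      "?X ^ (5 * ?b) * ?X ^ (3 * m) = ?X ^ (m * m) * (?X ^ (m * m) * (?X ^ ?b * ?X ^ m))"
      by (simp_all only: flip: power_add)
    then show ?thesis
      by (simp add: \<alpha>_def theta_coeff_def algebra_simps flip: power_mult)
  qed
  have \<alpha>_dvd: "?X ^ m dvd \<alpha> m" for m
    unfolding \<alpha> by (intro dvd_mult2 le_imp_power_dvd) simp

  \<comment> \<open>With z = 1 the factor of index i = 0 vanishes, so the triple product degenerates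
    to the unit Bailey pair.\<close>
  have unit: "?r (2 * n) * (\<Prod>i<n. (1 - 1 * ?X ^ i) * (1 - ?X * ?X ^ i)) = (if n = 0 then 1 else 0)" for n
  proof (cases n)
    case (Suc k)
    have "(\<Prod>i<n. (1 - 1 * ?X ^ i) * (1 - ?X * ?X ^ i)) = 0"
      unfolding Suc by (rule prod_zero) (auto intro: bexI[of _ 0])
    with Suc show ?thesis by simp
  qed simp
  have "bailey_pair ?X \<alpha> (\<lambda>n. \<Sum>s\<le>n. ?X ^ (s * s) * ?r (n - s)
      * (\<Sum>t\<le>s. ?X ^ (t * t) * ?r (s - t) * (if t = 0 then 1 else 0)))"
    using bailey_lemma[OF _ bailey_lemma[OF _ bailey_pair_theta[of ?X 1 ?X]]]
    unfolding unit \<alpha>[symmetric] by simp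
  moreover have "(\<Sum>t\<le>s. ?X ^ (t * t) * ?r (s - t) * (if t = 0 then 1 else 0)) = ?r s" for s
    by (simp add: if_distrib sum.delta cong: if_cong)
  ultimately have pair1: "bailey_pair (?X ^ 1) \<alpha> (\<lambda>n. \<Sum>s\<le>n. ?X ^ (s * s) * ?r (n - s) * ?r s)"
    by simp
  have "?X ^ Suc L dvd (\<Sum>s\<le>L. ?X ^ (s * s) * ?r (L - s) * ?r s) - ?r L * (?r L * \<Theta>)"
    using bailey_pair_limit[OF _ pair1 \<alpha>_dvd, of L] by (simp add: \<Theta>_def)
  \<comment> \<open>Replacing L - s by L costs an error of order L - s + 1; the factor
    \<open>?X ^ (s * s)\<close> makes up for it since s \<le> s^2.\<close>
  moreover have "?X ^ Suc L dvd (\<Sum>s\<le>L. ?X ^ (s * s) * ?r (L - s) * ?r s) - ?r L * S"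
  proof -
    have "?X ^ Suc L dvd ?X ^ (s * s) * (?r (L - s) - ?r L) * ?r s" if "s \<le> L" for s
    proof -
      have "?X ^ (s * s + Suc (L - s)) dvd ?X ^ (s * s) * (?r (L - s) - ?r L)"
        unfolding power_add using recip_qpoch_stable'[of 1 "L - s" L "Suc (L - s)", where 'a = 'a]
        by (intro mult_dvd_mono) simp_all
      moreover have "Suc L \<le> s * s + Suc (L - s)"
        using that le_square[of s] by linarith
      ultimately show ?thesis by (meson power_le_dvd dvd_mult2)
    qed
    then have "?X ^ Suc L dvd (\<Sum>s\<le>L. ?X ^ (s * s) * (?r (L - s) - ?r L) * ?r s)"
      by (intro dvd_sum) auto
    then show ?thesis
      by (simp add: S_def sum_distrib_left sum_subtractf algebra_simps del: power_Suc)
  qed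
  ultimately have "?X ^ Suc L dvd ?r L * S - ?r L * (?r L * \<Theta>)"
    by (rule X_power_dvd_trans[OF X_power_dvd_sym, rotated])
  then have "?X ^ Suc L dvd ?r L * (S - ?r L * \<Theta>)"
    by (simp only: right_diff_distrib)
  then have S: "?X ^ Suc L dvd S - ?r L * \<Theta>"
    by (rule dvd_recip_qpoch_mult_cancel[rotated]) simp

  have pair5: "bailey_pair (?X ^ 5) \<alpha> (\<lambda>n. ?r5 (2 * n) * P n)"
    unfolding \<alpha>_def P_def by (intro bailey_pair_theta) (simp_all flip: power_add)
  have "?X ^ Suc L dvd ?r5 (2 * L) * P L - ?r5 L * (?r5 L * \<Theta>)"
    using bailey_pair_limit[OF _ pair5 \<alpha>_dvd, of L] by (simp add: \<Theta>_def)
  \<comment> \<open>Lowering the index 2L to L makes the unit \<open>?r5 L\<close> a common factor,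
    which can then be cancelled.\<close>
  moreover have "?X ^ Suc L dvd (?r5 L - ?r5 (2 * L)) * P L"
    by (intro dvd_mult2 recip_qpoch_stable') auto
  ultimately have "?X ^ Suc L dvd (?r5 (2 * L) * P L - ?r5 L * (?r5 L * \<Theta>)) + (?r5 L - ?r5 (2 * L)) * P L"
    by (rule dvd_add)
  then have "?X ^ Suc L dvd ?r5 L * (P L - ?r5 L * \<Theta>)"
    by (simp add: algebra_simps del: power_Suc)
  then have "?X ^ Suc L dvd P L - ?r5 L * \<Theta>"
    by (rule dvd_recip_qpoch_mult_cancel[rotated]) simp
  then have "?X ^ Suc L dvd ?r (5 * L) * (P L - ?r5 L * \<Theta>)"
    by (rule dvd_mult)
  moreover have "?r (5 * L) * P L = ?r5 L * G"
    unfolding P_def G_def by (rule recip_qpoch_mod_5)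
  moreover have "?X ^ Suc L dvd (?r L - ?r (5 * L)) * (?r5 L * \<Theta>)"
    using recip_qpoch_stable'[of 1 L "5 * L" "Suc L", where 'a = 'a] by (intro dvd_mult2) simp
  \<comment> \<open>The last bracket is zero by the preceding dissection modulo 5; with it the
    equation is purely algebraic.\<close>
  moreover have "?r5 L * (G - ?r L * \<Theta>)
      = ?r (5 * L) * (P L - ?r5 L * \<Theta>) - (?r L - ?r (5 * L)) * (?r5 L * \<Theta>)
        + (?r5 L * G - ?r (5 * L) * P L)"
    by (simp add: algebra_simps)
  ultimately have "?X ^ Suc L dvd ?r5 L * (G - ?r L * \<Theta>)"
    by (simp del: power_Suc)
  then have "?X ^ Suc L dvd G - ?r L * \<Theta>"
    by (rule dvd_recip_qpoch_mult_cancel[rotated]) simp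
  with S show ?thesis
    unfolding S_def G_def by (rule X_power_dvd_trans[OF _ X_power_dvd_sym])
qed

section \<open>Generating functions of partitions\<close>

text \<open>Partitions are encoded by their multiplicities. The value 0 outside \<open>S\<close>
  ensures that each partition has only one code.\<close>

definition mult_functions :: "nat set \<Rightarrow> (nat \<Rightarrow> nat set) \<Rightarrow> nat \<Rightarrow> (nat \<Rightarrow> nat) set" where
  "mult_functions S A N =
     {f. (\<forall>x. x \<notin> S \<longrightarrow> f x = 0) \<and> (\<forall>x\<in>S. f x \<in> A x) \<and> (\<Sum>x\<in>S. x * f x) = N}"

text \<open>For x > 0 this is the sum of X^(x i) over i in \<open>B\<close>: the contribution of the
  part x when its multiplicity is restricted to \<open>B\<close>.\<close>

definition part_fps :: "nat \<Rightarrow> nat set \<Rightarrow> rat fps" where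
  "part_fps x B = Abs_fps (\<lambda>n. of_bool (x dvd n \<and> n div x \<in> B))"

text \<open>Splitting off the part x separates its weight \<open>x * f x\<close> from a function on
  \<open>S\<close> for the remaining weight, and counting such pairs is the Cauchy product.\<close>

lemma card_mult_functions:
  assumes "finite S" "0 \<notin> S"
  shows "finite (mult_functions S A N) \<and>
    of_nat (card (mult_functions S A N)) = (\<Prod>x\<in>S. part_fps x (A x)) $ N"
  using assms
proof (induction S arbitrary: N rule: finite_induct)
  case empty
  have "mult_functions {} A N = (if N = 0 then {\<lambda>_. 0} else {})"
    by (auto simp: mult_functions_def)
  then show ?case by simp
next
  case (insert x S)
  then have x: "0 < x" and IH: "finite (mult_functions S A n)"
    "of_nat (card (mult_functions S A n)) = (\<Prod>x\<in>S. part_fps x (A x)) $ n" for n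
    by auto
  \<comment> \<open>The possible weights \<open>x * f x\<close>, not the multiplicities, so that
    they index the Cauchy product directly.\<close>
  define I where "I = {i \<in> {0..N}. x dvd i \<and> i div x \<in> A x}"
  have bij: "bij_betw (\<lambda>f. (x * f x, f(x := 0))) (mult_functions (insert x S) A N)
      (Sigma I (\<lambda>i. mult_functions S A (N - i)))"
  proof (rule bij_betw_byWitness[where f' = "\<lambda>(i, g). g(x := i div x)"])
    have upd: "(\<Sum>y\<in>S. y * (if y = x then c else f y)) = (\<Sum>y\<in>S. y * f y)" for f c
      using insert.hyps by (intro sum.cong) auto
    show "\<forall>f\<in>mult_functions (insert x S) A N. (case (x * f x, f(x := 0)) of (i, g) \<Rightarrow> g(x := i div x)) = f"
      using x by auto
    show "\<forall>p\<in>Sigma I (\<lambda>i. mult_functions S A (N - i)).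
        (x * (case p of (i, g) \<Rightarrow> g(x := i div x)) x, (case p of (i, g) \<Rightarrow> g(x := i div x))(x := 0)) = p"
      using insert.hyps by (auto simp: I_def mult_functions_def fun_eq_iff)
    show "(\<lambda>f. (x * f x, f(x := 0))) ` mult_functions (insert x S) A N
        \<subseteq> Sigma I (\<lambda>i. mult_functions S A (N - i))"
      using insert.hyps x by (auto simp: I_def mult_functions_def upd)
    show "(\<lambda>(i, g). g(x := i div x)) ` Sigma I (\<lambda>i. mult_functions S A (N - i))
        \<subseteq> mult_functions (insert x S) A N"
      using insert.hyps by (auto simp: I_def mult_functions_def upd)
  qed
  have fin: "finite I" by (simp add: I_def)
  have "of_nat (card (mult_functions (insert x S) A N))
      = of_nat (card (Sigma I (\<lambda>i. mult_functions S A (N - i))))"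
    using bij_betw_same_card[OF bij] by simp
  also have "\<dots> = (\<Sum>i\<in>I. (\<Prod>x\<in>S. part_fps x (A x)) $ (N - i))"
    using fin IH by (simp add: card_SigmaI)
  also have "\<dots> = (\<Sum>i=0..N. part_fps x (A x) $ i * (\<Prod>x\<in>S. part_fps x (A x)) $ (N - i))"
    unfolding I_def by (subst sum.inter_filter) (simp, intro sum.cong refl, simp add: part_fps_def)
  finally have "of_nat (card (mult_functions (insert x S) A N)) = (\<Prod>x\<in>insert x S. part_fps x (A x)) $ N"
    using insert.hyps by (simp add: fps_mult_nth)
  moreover have "finite (mult_functions (insert x S) A N)"
    using bij_betw_finite[OF bij] fin IH(1) by auto
  ultimately show ?case by simp
qed

lemma part_fps_UNIV:
  assumes "0 < x"
  shows "part_fps x UNIV = inverse (1 - fps_X ^ x)"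
proof -
  have "part_fps x UNIV * (1 - fps_X ^ x) = 1"
  proof (rule fps_ext)
    fix n
    have "x dvd n \<longleftrightarrow> n = 0 \<or> x \<le> n \<and> x dvd n - x"
      using assms by (cases "x \<le> n") (auto dest: dvd_imp_le simp: dvd_minus_self)
    then show "(part_fps x UNIV * (1 - fps_X ^ x)) $ n = 1 $ n"
      using assms by (auto simp: part_fps_def right_diff_distrib fps_X_power_mult_right_nth)
  qed
  then show ?thesis
    using fps_inverse_unique by (metis mult.commute)
qed

lemma part_fps_single:
  assumes "0 < x"
  shows "part_fps x {k} = fps_X ^ (x * k)"
  by (rule fps_ext) (use assms in \<open>auto simp: part_fps_def fps_X_power_nth\<close>)

text \<open>The sum telescopes. It is used for x = 1 with an interval of length M + 1 and for x = M
  + 1 with an interval of length 1, where the right-hand sides coincide.\<close>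

lemma part_fps_interval:
  assumes "0 < x"
  shows "(1 - fps_X ^ x) * part_fps x {a..<a + b} = fps_X ^ (x * a) * (1 - fps_X ^ (x * b))"
proof (induction b)
  case 0
  have "part_fps x {} = 0" by (simp add: part_fps_def fps_eq_iff)
  then show ?case by simp
next
  case (Suc b)
  have "part_fps x {a..<a + Suc b} = part_fps x {a..<a + b} + part_fps x {a + b}"
    by (rule fps_ext) (auto simp: part_fps_def of_bool_def less_Suc_eq)
  then have "(1 - fps_X ^ x) * part_fps x {a..<a + Suc b}
      = fps_X ^ (x * a) * (1 - fps_X ^ (x * b)) + (1 - fps_X ^ x) * fps_X ^ (x * (a + b))"
    by (simp only: distrib_left Suc.IH part_fps_single[OF assms])
  then show ?case
    by (simp add: power_add algebra_simps)
qed

section \<open>Partitions as multiplicity functions\<close>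

lemma partition_eqI:
  assumes "is_partition p" "is_partition p'" "count_list p = count_list p'"
  shows "p = p'"
proof -
  have "mset p = mset p'"
    using assms(3) by (intro multiset_eqI) (simp add: count_mset)
  moreover have "sorted (rev p)" "sorted (rev p')"
    using assms(1,2) by (simp_all add: is_partition_def sorted_wrt_rev)
  ultimately have "rev p = rev p'"
    by (metis mset_rev properties_for_sort)
  then show ?thesis by simp
qed

lemma partition_exists:
  assumes "finite S" "0 \<notin> S" "\<And>x. x \<notin> S \<Longrightarrow> f x = 0"
  shows "\<exists>p. is_partition p \<and> count_list p = f"
proof -
  have "finite {x. 0 < f x}"
    by (rule finite_subset[OF _ assms(1)]) (use assms(3) in force)
  then have c: "count (Abs_multiset f) = f" by simp
  define p where "p = rev (sorted_list_of_multiset (Abs_multiset f))"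
  have "mset p = Abs_multiset f" by (simp add: p_def)
  then have count: "count_list p = f" by (simp add: fun_eq_iff c flip: count_mset)
  moreover have "0 \<notin> set p"
  proof
    assume "0 \<in> set p"
    then have "count_list p 0 \<noteq> 0" by (simp add: count_list_0_iff)
    with count assms show False by auto
  qed
  then have "is_partition p"
    unfolding is_partition_def by (auto simp: p_def sorted_wrt_rev intro: gr0I)
  ultimately show ?thesis by blast
qed

lemma bij_betw_count_list_partitions:
  assumes "finite S" "0 \<notin> S"
  shows "bij_betw count_list
    {p \<in> partitions_of N. set p \<subseteq> S \<and> (\<forall>x\<in>S. count_list p x \<in> A x)} (mult_functions S A N)"
proof (rule bij_betwI')
  fix p p'
  assume "p \<in> {p \<in> partitions_of N. set p \<subseteq> S \<and> (\<forall>x\<in>S. count_list p x \<in> A x)}"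
    "p' \<in> {p \<in> partitions_of N. set p \<subseteq> S \<and> (\<forall>x\<in>S. count_list p x \<in> A x)}"
  then show "(count_list p = count_list p') = (p = p')"
    using partition_eqI by (auto simp: partitions_of_def)
next
  fix p
  assume "p \<in> {p \<in> partitions_of N. set p \<subseteq> S \<and> (\<forall>x\<in>S. count_list p x \<in> A x)}"
  then show "count_list p \<in> mult_functions S A N"
    using sum_list_map_eq_sum_count2[of p S "\<lambda>x. x"] assms
    by (auto simp: mult_functions_def partitions_of_def count_list_0_iff mult.commute)
next
  fix f assume f: "f \<in> mult_functions S A N"
  then obtain p where p: "is_partition p" "count_list p = f"
    using partition_exists[OF assms, of f] by (auto simp: mult_functions_def)
  have "set p \<subseteq> S"
    using f p(2) by (auto simp: mult_functions_def count_list_0_iff)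
  then show "\<exists>p\<in>{p \<in> partitions_of N. set p \<subseteq> S \<and> (\<forall>x\<in>S. count_list p x \<in> A x)}. f = count_list p"
    using sum_list_map_eq_sum_count2[of p S "\<lambda>x. x"] assms p f
    by (intro bexI[of _ p]) (auto simp: mult_functions_def partitions_of_def mult.commute)
qed

section \<open>Multiplicities in the conjugate\<close>

text \<open>In a weakly decreasing list the entries above i form a prefix, and the filter measures
  its length.\<close>

lemma less_nth_iff_less_length_filter:
  fixes xs :: "nat list"
  assumes "sorted_wrt (\<ge>) xs" "t < length xs"
  shows "i < xs ! t \<longleftrightarrow> t < length (filter (\<lambda>x. i < x) xs)"
  using assms
proof (induction xs arbitrary: t)
  case (Cons x xs)
  show ?case
  proof (cases "i < x")
    case True
    then show ?thesis using Cons by (cases t) auto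
  next
    case False
    then have le: "\<forall>y\<in>set (x # xs). y \<le> i" using Cons.prems by auto
    then have "(x # xs) ! t \<le> i" using Cons.prems(2) nth_mem by blast
    moreover have "filter (\<lambda>x. i < x) (x # xs) = []" using le by (auto simp: filter_empty_conv)
    ultimately show ?thesis by simp
  qed
qed simp

lemma length_filter_eq_iff:
  fixes xs :: "nat list"
  assumes "sorted_wrt (\<ge>) xs" "1 \<le> j" "j \<le> length xs"
  shows "length (filter (\<lambda>x. i < x) xs) = j
    \<longleftrightarrow> i < xs ! (j - 1) \<and> (j < length xs \<longrightarrow> xs ! j \<le> i)"
proof -
  define h where "h = length (filter (\<lambda>x. i < x) xs)"
  have h: "h \<le> length xs"
    unfolding h_def by (rule length_filter_le)
  have 1: "i < xs ! (j - 1) \<longleftrightarrow> j - 1 < h"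
    using less_nth_iff_less_length_filter[OF assms(1), of "j - 1" i] assms(2,3) by (simp add: h_def)
  have 2: "i < xs ! j \<longleftrightarrow> j < h" if "j < length xs"
    unfolding h_def by (rule less_nth_iff_less_length_filter[OF assms(1) that])
  show ?thesis
    unfolding h_def[symmetric]
  proof (cases "j < length xs")
    case True
    then show "h = j \<longleftrightarrow> i < xs ! (j - 1) \<and> (j < length xs \<longrightarrow> xs ! j \<le> i)"
      using 1 2 assms(2) by linarith
  next
    case False
    then show "h = j \<longleftrightarrow> i < xs ! (j - 1) \<and> (j < length xs \<longrightarrow> xs ! j \<le> i)"
      using 1 h assms(2) by linarith
  qed
qed

lemma count_list_map_upt: "count_list (map h [0..<n]) y = card {i. i < n \<and> h i = y}"
proof -
  have "{i. i < n \<and> y = h ([0..<n] ! i)} = {i. i < n \<and> h i = y}" by auto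
  then show ?thesis
    by (simp add: count_list_eq_length_filter filter_map length_filter_conv_card)
qed

text \<open>The columns of height j are those that meet row j but not row j + 1, counting rows from
  1; below the last row the missing row counts as 0.\<close>

lemma count_list_conjugate:
  assumes "sorted_wrt (\<ge>) xs" "1 \<le> j" "j \<le> length xs"
  shows "count_list (conjugate xs) j = xs ! (j - 1) - (if j < length xs then xs ! j else 0)"
proof -
  let ?m = "Max (insert 0 (set xs))" and ?h = "\<lambda>i. length (filter (\<lambda>x. i < x) xs)"
  have "count_list (conjugate xs) j = card {i. i < ?m \<and> ?h i = j}"
    unfolding conjugate_def by (rule count_list_map_upt)
  also have "{i. i < ?m \<and> ?h i = j} = {(if j < length xs then xs ! j else 0)..<xs ! (j - 1)}"
  proof -
    have "xs ! (j - 1) \<le> ?m" using assms by (intro Max_ge) auto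
    then have "i < ?m" if "i < xs ! (j - Suc 0)" for i
      using that by (metis One_nat_def less_le_trans)
    then show ?thesis
      unfolding length_filter_eq_iff[OF assms] by (cases "j < length xs") auto
  qed
  finally show ?thesis by simp
qed

text \<open>Here \<open>e\<close> is the sequence of rows, extended by zeros, of a diagram.\<close>

lemma sum_mult_diff:
  fixes e :: "nat \<Rightarrow> nat"
  assumes "\<And>i. e (Suc i) \<le> e i"
  shows "(\<Sum>j=1..n. j * (e (j - 1) - e j)) + n * e n = (\<Sum>i<n. e i)"
proof (induction n)
  case (Suc n)
  have "Suc n * (e n - e (Suc n)) + Suc n * e (Suc n) = Suc n * e n"
    using assms[of n] by (simp flip: add_mult_distrib2)
  then show ?case using Suc by simp
qed simp

lemma sum_diff_tail:
  fixes e :: "nat \<Rightarrow> nat"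
  assumes "\<And>i. e (Suc i) \<le> e i" "i \<le> n"
  shows "(\<Sum>j=Suc i..n. e (j - 1) - e j) + e n = e i"
  using assms(2)
proof (induction n rule: dec_induct)
  case (step n)
  then show ?case using assms(1)[of n] by simp
qed simp

section \<open>\<open>Diff2\<close> partitions with a fixed number of parts\<close>

text \<open>The zero tail acts as the row below the last one, so that multiplicities in
  \<open>col p\<close> are differences of consecutive values without a special case at j =
  \<open>length p\<close>.\<close>

definition excess :: "nat list \<Rightarrow> nat \<Rightarrow> nat" where
  "excess p i = (if i < length p then p ! i - (2 * (length p - i) - 1) else 0)"

lemma Diff2_nth_excess:
  assumes "p \<in> Diff2" "i < length p"
  shows "p ! i = excess p i + (2 * (length p - i) - 1)"
  using Diff2_staircase[OF assms] assms(2) by (simp add: excess_def)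

lemma excess_antimono:
  assumes "p \<in> Diff2"
  shows "excess p (Suc i) \<le> excess p i"
proof (cases "Suc i < length p")
  case True
  then have "p ! (i + 1) + 2 \<le> p ! i" using assms by (simp add: Diff2_def)
  with True show ?thesis by (simp add: excess_def)
qed (simp add: excess_def)

lemma count_list_col:
  assumes "p \<in> Diff2" "1 \<le> j" "j \<le> length p"
  shows "count_list (col p) j = excess p (j - 1) - excess p j"
proof -
  let ?xs = "map (\<lambda>i. p ! i - (2 * (length p - i) - 1)) [0..<length p]"
  have anti: "excess p b \<le> excess p a" if "a \<le> b" for a b
    using lift_Suc_antimono_le[of "excess p"] excess_antimono[OF assms(1)] that by blast
  have nth: "?xs ! i = excess p i" if "i < length p" for i
    using that by (simp add: excess_def)
  have "sorted_wrt (\<ge>) ?xs"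
    unfolding sorted_wrt_iff_nth_less using anti nth by (simp del: nth_map)
  then show ?thesis
    unfolding col_def Let_def using assms nth[of "j - 1"] nth[of j]
    by (subst count_list_conjugate) (auto simp: excess_def)
qed

lemma sum_staircase: "(\<Sum>i<m. 2 * (m - i) - 1) = m * (m :: nat)"
proof (induction m)
  case (Suc m)
  have "(\<Sum>i<Suc m. 2 * (Suc m - i) - 1) = (2 * Suc m - 1) + (\<Sum>i<m. 2 * (m - i) - 1)"
    by (subst sum.lessThan_Suc_shift) simp
  then show ?case using Suc by simp
qed simp

text \<open>Summation by parts turns the total excess into the size of \<open>col p\<close>, and the
  staircase adds \<open>m * m\<close>.\<close>

lemma sum_list_Diff2:
  assumes "p \<in> Diff2" "length p = m"
  shows "sum_list p = (\<Sum>j=1..m. j * count_list (col p) j) + m * m"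
proof -
  have "sum_list p = (\<Sum>i<m. excess p i + (2 * (m - i) - 1))"
    using assms Diff2_nth_excess[OF assms(1)] by (simp add: sum_list_sum_nth atLeast0LessThan)
  also have "\<dots> = (\<Sum>i<m. excess p i) + m * m"
    by (simp only: sum.distrib sum_staircase)
  also have "(\<Sum>i<m. excess p i) = (\<Sum>j=1..m. j * (excess p (j - 1) - excess p j))"
    using sum_mult_diff[of "excess p" m, OF excess_antimono[OF assms(1)]] assms(2)
    by (simp add: excess_def)
  also have "\<dots> = (\<Sum>j=1..m. j * count_list (col p) j)"
    using assms by (intro sum.cong refl) (simp add: count_list_col)
  finally show ?thesis .
qed

text \<open>The inverse of \<open>col\<close> for a given number m of parts: row i, counted from 0,
  exceeds the staircase by the number of columns of height at least i + 1.\<close>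

definition from_col :: "nat \<Rightarrow> (nat \<Rightarrow> nat) \<Rightarrow> nat list" where
  "from_col m g = map (\<lambda>i. (\<Sum>j=Suc i..m. g j) + (2 * (m - i) - 1)) [0..<m]"

lemma length_from_col [simp]: "length (from_col m g) = m"
  by (simp add: from_col_def)

lemma from_col_Diff2: "from_col m g \<in> Diff2"
proof -
  have step: "from_col m g ! (i + 1) + 2 \<le> from_col m g ! i" if "i + 1 < m" for i
    using that by (simp add: from_col_def sum.atLeast_Suc_atMost[of "Suc i"])
  have "from_col m g ! j \<le> from_col m g ! i" if "i < j" "j < m" for i j
  proof -
    have "(\<Sum>t=Suc j..m. g t) \<le> (\<Sum>t=Suc i..m. g t)"
      using that by (intro sum_mono2) auto
    then show ?thesis using that by (simp add: from_col_def)
  qed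
  moreover have "0 < x" if "x \<in> set (from_col m g)" for x
    using that by (auto simp: from_col_def)
  ultimately show ?thesis
    using step by (simp add: Diff2_def is_partition_def sorted_wrt_iff_nth_less)
qed

lemma excess_from_col: "excess (from_col m g) i = (\<Sum>j=Suc i..m. g j)"
  by (simp add: excess_def from_col_def)

lemma count_list_col_from_col:
  assumes "1 \<le> j" "j \<le> m"
  shows "count_list (col (from_col m g)) j = g j"
  using assms by (simp add: count_list_col[OF from_col_Diff2] excess_from_col sum.atLeast_Suc_atMost)

lemma from_col_count_list_col:
  assumes "p \<in> Diff2" "length p = m" "\<And>j. 1 \<le> j \<Longrightarrow> j \<le> m \<Longrightarrow> g j = count_list (col p) j"
  shows "from_col m g = p"
proof (rule nth_equalityI)
  fix i assume "i < length (from_col m g)"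
  then have i: "i < m" by simp
  have "(\<Sum>j=Suc i..m. g j) = (\<Sum>j=Suc i..m. excess p (j - 1) - excess p j)"
    using assms by (intro sum.cong refl) (simp add: count_list_col)
  also have "\<dots> = excess p i"
    using sum_diff_tail[of "excess p" i m, OF excess_antimono[OF assms(1)]] i assms(2)
    by (simp add: excess_def)
  finally show "from_col m g ! i = p ! i"
    using i Diff2_nth_excess[OF assms(1), of i] assms(2) by (simp add: from_col_def)
qed (simp add: assms)

text \<open>The number of parts is fixed because \<open>col\<close> does not determine it: every
  bare staircase has an empty \<open>col\<close>.\<close>

lemma bij_betw_from_col:
  assumes "m * m \<le> N"
  shows "bij_betw (from_col m) (mult_functions {1..m} A (N - m * m))
    {p \<in> Diff2. length p = m \<and> sum_list p = N \<and> (\<forall>j\<in>{1..m}. count_list (col p) j \<in> A j)}"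
proof (rule bij_betw_byWitness[where f' = "\<lambda>p j. if j \<in> {1..m} then count_list (col p) j else 0"])
  show "\<forall>g\<in>mult_functions {1..m} A (N - m * m).
      (\<lambda>j. if j \<in> {1..m} then count_list (col (from_col m g)) j else 0) = g"
    by (auto simp: mult_functions_def count_list_col_from_col fun_eq_iff)
  show "\<forall>p\<in>{p \<in> Diff2. length p = m \<and> sum_list p = N \<and> (\<forall>j\<in>{1..m}. count_list (col p) j \<in> A j)}.
      from_col m (\<lambda>j. if j \<in> {1..m} then count_list (col p) j else 0) = p"
    by (auto intro: from_col_count_list_col)
  show "from_col m ` mult_functions {1..m} A (N - m * m)
    \<subseteq> {p \<in> Diff2. length p = m \<and> sum_list p = N \<and> (\<forall>j\<in>{1..m}. count_list (col p) j \<in> A j)}"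
  proof
    fix p assume "p \<in> from_col m ` mult_functions {1..m} A (N - m * m)"
    then obtain g where g: "g \<in> mult_functions {1..m} A (N - m * m)" "p = from_col m g" by blast
    have "(\<Sum>j=1..m. j * count_list (col p) j) = (\<Sum>j=1..m. j * g j)"
      unfolding g(2) by (intro sum.cong refl) (simp add: count_list_col_from_col)
    then have "sum_list p = N"
      using g(1) assms sum_list_Diff2[of p m] by (simp add: g(2) from_col_Diff2 mult_functions_def)
    then show "p \<in> {p \<in> Diff2. length p = m \<and> sum_list p = N \<and> (\<forall>j\<in>{1..m}. count_list (col p) j \<in> A j)}"
      using g by (simp add: from_col_Diff2 mult_functions_def count_list_col_from_col)
  qed
  show "(\<lambda>p j. if j \<in> {1..m} then count_list (col p) j else 0) `
      {p \<in> Diff2. length p = m \<and> sum_list p = N \<and> (\<forall>j\<in>{1..m}. count_list (col p) j \<in> A j)}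
    \<subseteq> mult_functions {1..m} A (N - m * m)"
    by (auto simp: mult_functions_def sum_list_Diff2)
qed

lemma card_Diff2_length:
  "of_nat (card {p \<in> Diff2. length p = m \<and> sum_list p = N \<and> (\<forall>j\<in>{1..m}. count_list (col p) j \<in> A j)})
   = (fps_X ^ (m * m) * (\<Prod>j=1..m. part_fps j (A j))) $ N"
proof (cases "m * m \<le> N")
  case True
  then show ?thesis
    using bij_betw_same_card[OF bij_betw_from_col[OF True, of A]]
      card_mult_functions[of "{1..m}" A "N - m * m"]
    by (simp add: fps_X_power_mult_nth)
next
  \<comment> \<open>The staircase alone already exceeds N, and the coefficient is 0 as well.\<close>
  case False
  then have "{p \<in> Diff2. length p = m \<and> sum_list p = N \<and> (\<forall>j\<in>{1..m}. count_list (col p) j \<in> A j)} = {}"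
    using sum_list_Diff2[of _ m] by auto
  with False show ?thesis by (simp only:) (simp add: fps_X_power_mult_nth)
qed

section \<open>Restricting one multiplicity and comparing the two counts\<close>

lemma prod_mod_5:
  fixes f :: "nat \<Rightarrow> 'a::comm_monoid_mult"
  shows "(\<Prod>x\<in>{x \<in> {1..5 * L}. x mod 5 = 1 \<or> x mod 5 = 4}. f x) = (\<Prod>i<L. f (5 * i + 1) * f (5 * i + 4))"
proof (induction L)
  case (Suc L)
  have "{1..5 * Suc L}
      = {1..5 * L} \<union> {5 * L + 1, 5 * L + 2, 5 * L + 3, 5 * L + 4, 5 * L + 5}"
    by auto
  moreover have "Suc (Suc (5 * L)) mod 5 = 2" by presburger
  ultimately have "{x \<in> {1..5 * Suc L}. x mod 5 = 1 \<or> x mod 5 = 4}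
      = insert (5 * L + 1) (insert (5 * L + 4) {x \<in> {1..5 * L}. x mod 5 = 1 \<or> x mod 5 = 4})"
    by auto
  then show ?case using Suc by (simp add: mult_ac)
qed simp

text \<open>Unrestricted parts give geometric series; restricting the part a only turns the factor
  1/(1 - X^a) into F/(1 - X^a).\<close>

lemma prod_part_fps_fun_upd:
  assumes "finite S" "0 \<notin> S" "a \<in> S" and F: "(1 - fps_X ^ a) * part_fps a D = F"
  shows "(\<Prod>x\<in>S. part_fps x (if x = a then D else UNIV)) = F * (\<Prod>x\<in>S. inverse (1 - fps_X ^ x))"
proof -
  have pos: "0 < x" if "x \<in> S" for x using that assms(2) by (cases x) auto
  have "(1 - fps_X ^ a) * inverse (1 - fps_X ^ a :: rat fps) = 1"
    using pos[OF assms(3)] by (intro one_minus_mult_inverse) simp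
  then have D: "part_fps a D = F * inverse (1 - fps_X ^ a)"
    unfolding F[symmetric] by (simp add: mult_ac)
  have "(\<Prod>x\<in>S. part_fps x (if x = a then D else UNIV))
      = part_fps a D * (\<Prod>x\<in>S - {a}. inverse (1 - fps_X ^ x))"
    using assms(1,3) by (simp add: prod.remove part_fps_UNIV pos)
  also have "\<dots> = F * (\<Prod>x\<in>S. inverse (1 - fps_X ^ x))"
    using assms(1,3) by (simp add: D prod.remove[of S a] mult.assoc)
  finally show ?thesis .
qed

theorem theorem3:
  fixes M N k :: nat
  assumes "M + 1 \<ge> 2"
    and "(M + 1) mod 5 = 1 \<or> (M + 1) mod 5 = 4"
    and "N \<ge> 1"
  shows "card {p \<in> partitions_of N.
            (\<forall>x\<in>set p. x mod 5 = 1 \<or> x mod 5 = 4) \<and> count_list p (M + 1) = k}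
       = card {p \<in> partitions_of N. p \<in> Diff2 \<and>
            ((length p = 1 \<and> (\<exists>i\<le>M. N = (M + 1) * k + i))
           \<or> (2 \<le> length p \<and> length p \<le> M \<and>
                (M + 1) * k \<le> count_list (col p) 1 \<and> count_list (col p) 1 \<le> (M + 1) * k + M)
           \<or> (M + 1 \<le> length p \<and> count_list (col p) (M + 1) = k))}"
    (is "card ?lhs = card ?rhs")
proof -
  \<comment> \<open>\<open>L\<close> is at least N, so that precision X^(L + 1) determines the
    coefficient at N and every relevant length is at most L; it is at least M + 1, so that the part
    M + 1 survives the cutoff at 5L.\<close>
  define L where "L = N + M + 1"
  define C :: "rat fps" where "C = fps_X ^ ((M + 1) * k) * (1 - fps_X ^ (M + 1))"
  define I where "I = {(M + 1) * k..<(M + 1) * k + (M + 1)}"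
  let ?r = "recip_qpoch (fps_X :: rat fps)"

  have F1: "(1 - fps_X ^ 1) * part_fps 1 I = C"
    unfolding I_def C_def by (subst part_fps_interval) simp_all
  have F2: "(1 - fps_X ^ (M + 1)) * part_fps (M + 1) {k} = C"
    using part_fps_interval[of "M + 1" k 1] by (simp add: C_def)

  have lhs: "of_nat (card ?lhs)
      = (C * (\<Prod>i<L. inverse (1 - fps_X ^ (5 * i + 1)) * inverse (1 - fps_X ^ (5 * i + 4)))) $ N"
  proof -
    define S where "S = {x \<in> {1..5 * L}. x mod 5 = 1 \<or> x mod 5 = 4}"
    define A where "A x = (if x = M + 1 then {k} else UNIV)" for x
    have S: "finite S" "0 \<notin> S" "M + 1 \<in> S"
      using assms(2) by (auto simp: S_def L_def)
    \<comment> \<open>No part exceeds N, so cutting off at 5L loses none.\<close>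
    have "set p \<subseteq> {1..5 * L}" if "p \<in> partitions_of N" for p
      using that member_le_sum_list[of _ p]
      by (fastforce simp: partitions_of_def is_partition_def L_def Suc_le_eq)
    then have "?lhs = {p \<in> partitions_of N. set p \<subseteq> S \<and> (\<forall>x\<in>S. count_list p x \<in> A x)}"
      using S(3) by (auto simp: S_def A_def subset_iff)
    then have "of_nat (card ?lhs) = (\<Prod>x\<in>S. part_fps x (A x)) $ N"
      using bij_betw_same_card[OF bij_betw_count_list_partitions[OF S(1,2)]]
        card_mult_functions[OF S(1,2)] by metis
    also have "(\<Prod>x\<in>S. part_fps x (A x)) = C * (\<Prod>x\<in>S. inverse (1 - fps_X ^ x))"
      unfolding A_def by (rule prod_part_fps_fun_upd[OF S F2])
    finally show ?thesis unfolding S_def prod_mod_5 .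
  qed

  have rhs: "of_nat (card ?rhs) = (C * (\<Sum>s\<le>L. fps_X ^ (s * s) * ?r s)) $ N"
  proof -
    \<comment> \<open>With m parts, \<open>col\<close> has parts up to m. The multiplicity of M + 1
      is restricted once m reaches M + 1, and that of 1 before.\<close>
    define B where "B m j = (if j = (if m \<le> M then 1 else M + 1)
        then if m \<le> M then I else {k} else UNIV)" for m j
    define R where "R m = {p \<in> Diff2. length p = m \<and> sum_list p = N
        \<and> (\<forall>j\<in>{1..m}. count_list (col p) j \<in> B m j)}" for m
    define R1 where "R1 = {p. p = [N] \<and> N \<in> I}"
    have one: "[N] \<in> Diff2"
      using assms(3) by (simp add: Diff2_def is_partition_def)
    have len: "length p \<le> sum_list p" if "p \<in> Diff2" for p
    proof -
      have "length p \<le> length p * length p" by (rule le_square)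
      then show ?thesis using sum_list_Diff2[OF that refl] by linarith
    qed
    have I: "N \<in> I \<longleftrightarrow> (\<exists>i\<le>M. N = (M + 1) * k + i)"
      unfolding I_def atLeastLessThan_iff using le_Suc_ex[of "(M + 1) * k" N] by auto
    have R: "p \<in> R (length p) \<longleftrightarrow> p \<in> partitions_of N \<and> p \<in> Diff2 \<and>
          ((length p \<le> M \<and>
                (M + 1) * k \<le> count_list (col p) 1 \<and> count_list (col p) 1 \<le> (M + 1) * k + M)
           \<or> (M + 1 \<le> length p \<and> count_list (col p) (M + 1) = k))" if "2 \<le> length p" for p
      using that by (auto simp: R_def B_def I_def partitions_of_def Diff2_def split: if_splits)
    have R1: "p \<in> R1 \<longleftrightarrow> p \<in> partitions_of N \<and> p \<in> Diff2 \<and> length p = 1 \<and> N \<in> I" for p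
      using one by (cases p) (auto simp: R1_def partitions_of_def Diff2_def)
    \<comment> \<open>As \<open>M + 1 \<ge> 2\<close>, the third case contains no partition with
      fewer than two parts, so length 1 is left to \<open>R1\<close> alone.\<close>
    have "?rhs = R1 \<union> (\<Union>m\<in>{2..L}. R m)"
    proof (rule set_eqI)
      fix p
      have "p \<in> (\<Union>m\<in>{2..L}. R m) \<longleftrightarrow> 2 \<le> length p \<and> p \<in> R (length p)"
        using len[of p] by (auto simp: R_def L_def)
      then show "p \<in> ?rhs \<longleftrightarrow> p \<in> R1 \<union> (\<Union>m\<in>{2..L}. R m)"
        unfolding Un_iff R1 I mem_Collect_eq using R[of p] assms(1) by auto
    qed
    moreover have fin: "finite (R m)" for m
      by (rule finite_subset[OF _ finite_partitions_of[of N]])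
         (auto simp: R_def partitions_of_def Diff2_def)
    moreover have "finite R1" by (simp add: R1_def)
    moreover have "R1 \<inter> (\<Union>m\<in>{2..L}. R m) = {}" by (auto simp: R1_def R_def)
    ultimately have "card ?rhs = card R1 + card (\<Union>m\<in>{2..L}. R m)"
      by (simp add: card_Un_disjoint)
    also have "card (\<Union>m\<in>{2..L}. R m) = (\<Sum>m=2..L. card (R m))"
      by (rule card_UN_disjoint) (auto simp: fin, auto simp: R_def)
    finally have "of_nat (card ?rhs) = of_nat (card R1) + (\<Sum>m=2..L. of_nat (card (R m)) :: rat)"
      by simp
    also have "(\<Sum>m=2..L. of_nat (card (R m))) = (\<Sum>m=2..L. (C * (fps_X ^ (m * m) * ?r m)) $ N)"
    proof (intro sum.cong refl)
      fix m assume "m \<in> {2..L}"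
      then have m: "2 \<le> m" by simp
      have "(\<Prod>j=1..m. part_fps j (B m j)) = C * ?r m"
        unfolding B_def recip_qpoch_def using m F1 F2
        by (intro prod_part_fps_fun_upd) auto
      then show "of_nat (card (R m)) = (C * (fps_X ^ (m * m) * ?r m)) $ N"
        unfolding R_def card_Diff2_length by (simp add: mult_ac)
    qed
    \<comment> \<open>The terms s = 0 and s = 1 merge into \<open>part_fps 1 I\<close>, whose
      coefficient at N tells whether \<open>N \<in> I\<close>, that is, whether \<open>[N]\<close>
      is counted.\<close>
    also have "of_nat (card R1) = (C * (1 + fps_X * ?r 1)) $ N"
    proof -
      have inv: "(1 - fps_X) * inverse (1 - fps_X) = (1 :: rat fps)"
        by (rule one_minus_mult_inverse) simp
      then have "1 + fps_X * ?r 1 = inverse (1 - fps_X)"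
        by (simp add: recip_qpoch_def algebra_simps)
      then have "C * (1 + fps_X * ?r 1) = part_fps 1 I"
        using inv unfolding F1[symmetric] by (simp add: mult_ac)
      then show ?thesis by (auto simp: R1_def part_fps_def)
    qed
    also have "(C * (1 + fps_X * ?r 1)) $ N + (\<Sum>m=2..L. (C * (fps_X ^ (m * m) * ?r m)) $ N)
        = (C * ((1 + fps_X * ?r 1) + (\<Sum>m=2..L. fps_X ^ (m * m) * ?r m))) $ N"
      by (simp add: distrib_left sum_distrib_left fps_sum_nth)
    also have "(1 + fps_X * ?r 1) + (\<Sum>m=2..L. fps_X ^ (m * m) * ?r m) = (\<Sum>s\<le>L. fps_X ^ (s * s) * ?r s)"
    proof -
      have "{..L} = insert 0 (insert 1 {2..L})" using assms(3) by (auto simp: L_def)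
      then show ?thesis by (simp add: add.assoc)
    qed
    finally show ?thesis .
  qed

  have "fps_X ^ Suc L dvd C * ((\<Sum>s\<le>L. fps_X ^ (s * s) * ?r s)
      - (\<Prod>i<L. inverse (1 - fps_X ^ (5 * i + 1)) * inverse (1 - fps_X ^ (5 * i + 4))))"
    by (intro dvd_mult rogers_ramanujan_truncated)
  then obtain h where "C * (\<Sum>s\<le>L. fps_X ^ (s * s) * ?r s)
      - C * (\<Prod>i<L. inverse (1 - fps_X ^ (5 * i + 1)) * inverse (1 - fps_X ^ (5 * i + 4)))
      = fps_X ^ Suc L * h"
    unfolding right_diff_distrib by (rule dvdE)
  then have "of_nat (card ?rhs) - of_nat (card ?lhs) = (fps_X ^ Suc L * h) $ N"
    unfolding lhs rhs by (simp only: flip: fps_sub_nth)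
  also have "\<dots> = 0"
    by (simp only: fps_X_power_mult_nth) (simp add: L_def)
  finally show ?thesis by simp
qed

end
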